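(* Let $M$ be a connected $n$-dimensional coordinate domain with coordinates $(x^1,\dots,x^n)$. A Riemannian metric $g=(g_{ij})$ on $M$ satisfies the PDE system $$\frac{1}{2}g^{il}\left(\delta^r_l \delta^s_j \delta^t_k + \delta^r_l \delta^s_k \delta^t_j - \delta^t_l \delta^r_j \delta^s_k\right)\frac{\partial g_{rs}}{\partial x^t}=0,\qquad i,j,k=1,\dots,n,$$ (that is, $\Gamma^i_{jk}=0$ for all $i,j,k$) only if it is constant, and every constant metric is a solution; i.e. the only solutions are the constant Riemannian metrics $g_{ij}(x)=c_{ij}$.
   Context: Summation over repeated indices is understood; all indices run over $1,\dots,n$. The unknown $g=(g_{ij})$ is a smooth field of symmetric positive definite $n\times n$ matrices, $(g^{ij})$ is its inverse, $\delta^i_j$ is the Kronecker delta, and $\Gamma^i_{jk}=\frac12 g^{il}\left(\frac{\partial g_{lj}}{\partial x^k}+\frac{\partial g_{lk}}{\partial x^j}-\frac{\partial g_{jk}}{\partial x^l}\right)$ are the Christoffel symbols of the second kind. *)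

theory Defs
  imports "HOL-Analysis.Analysis"
begin

text \<open>On an open set \<open>S\<close>, all iterated directional derivatives of order less than \<open>k\<close> are Frechet
  differentiable and those of order \<open>k\<close> are continuous, i.e. \<open>f\<close> is of class \<open>C\<^sup>k\<close> on \<open>S\<close>.\<close>

primrec Ck_on :: "nat \<Rightarrow> ('a::real_normed_vector \<Rightarrow> 'b::real_normed_vector) \<Rightarrow> 'a set \<Rightarrow> bool" where
  "Ck_on 0 f S \<longleftrightarrow> continuous_on S f"
| "Ck_on (Suc k) f S \<longleftrightarrow> (\<forall>x\<in>S. f differentiable (at x)) \<and>
     (\<forall>v. Ck_on k (\<lambda>x. frechet_derivative f (at x) v) S)"

definition smooth_on :: "('a::real_normed_vector \<Rightarrow> 'b::real_normed_vector) \<Rightarrow> 'a set \<Rightarrow> bool" where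
  "smooth_on f S \<longleftrightarrow> (\<forall>k. Ck_on k f S)"

definition sym_pos_def :: "real^'n^'n \<Rightarrow> bool" where
  "sym_pos_def A \<longleftrightarrow> transpose A = A \<and> (\<forall>v. v \<noteq> 0 \<longrightarrow> v \<bullet> (A *v v) > 0)"

text \<open>A coordinate domain is identified with its image in \<open>\<real>\<^sup>n\<close> under the coordinates, an open set;
  a metric on it is then its matrix of components, with \<open>g x $ i $ j\<close> standing for \<open>g\<^sub>i\<^sub>j(x)\<close>. Values
  of \<open>g\<close> outside the domain are irrelevant.\<close>

definition riemannian_metric_on :: "(real^'n) set \<Rightarrow> (real^'n \<Rightarrow> real^'n^'n) \<Rightarrow> bool" where
  "riemannian_metric_on M g \<longleftrightarrow> smooth_on g M \<and> (\<forall>x\<in>M. sym_pos_def (g x))"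

definition partial_deriv :: "'n \<Rightarrow> (real^'n \<Rightarrow> real) \<Rightarrow> real^'n \<Rightarrow> real" where
  "partial_deriv t f x = frechet_derivative f (at x) (axis t 1)"

definition kronecker :: "'n \<Rightarrow> 'n \<Rightarrow> real" where
  "kronecker i j = (if i = j then 1 else 0)"

definition christoffel :: "(real^'n \<Rightarrow> real^'n^'n) \<Rightarrow> real^'n \<Rightarrow> 'n \<Rightarrow> 'n \<Rightarrow> 'n \<Rightarrow> real" where
  "christoffel g x i j k =
     1/2 * (\<Sum>l\<in>UNIV. matrix_inv (g x) $ i $ l *
       (partial_deriv k (\<lambda>y. g y $ l $ j) x + partial_deriv j (\<lambda>y. g y $ l $ k) x
        - partial_deriv l (\<lambda>y. g y $ j $ k) x))"

definition solves_pde_system :: "(real^'n) set \<Rightarrow> (real^'n \<Rightarrow> real^'n^'n) \<Rightarrow> bool" where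
  "solves_pde_system M g \<longleftrightarrow> (\<forall>x\<in>M. \<forall>i j k.
     1/2 * (\<Sum>l\<in>UNIV. \<Sum>r\<in>UNIV. \<Sum>s\<in>UNIV. \<Sum>t\<in>UNIV. matrix_inv (g x) $ i $ l *
       (kronecker r l * kronecker s j * kronecker t k
        + kronecker r l * kronecker s k * kronecker t j
        - kronecker t l * kronecker r j * kronecker s k) *
       partial_deriv t (\<lambda>y. g y $ r $ s) x) = 0)"

end

(* Lowering the upper index of the Christoffel symbols with g gives those of the first kind,
   [m; j k] = d_k g_mj + d_j g_mk - d_m g_jk (up to the factor 1/2). By the symmetry of g,
   [m; j k] + [j; m k] = 2 d_k g_mj, so vanishing Christoffel symbols force every first partial
   derivative of g to vanish, and g is constant because the domain is open and connected. *)
theory Submission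
  imports Defs
begin

lemma sum_kronecker:
  fixes f :: "'n::finite \<Rightarrow> real"
  shows "(\<Sum>r\<in>UNIV. kronecker r a * f r) = f a"
  by (simp add: kronecker_def if_distrib[of "\<lambda>z. z * _"] cong: if_cong)

lemma sum_kronecker3:
  fixes F :: "'n::finite \<Rightarrow> 'n \<Rightarrow> 'n \<Rightarrow> real"
  shows "(\<Sum>r\<in>UNIV. \<Sum>s\<in>UNIV. \<Sum>t\<in>UNIV. kronecker r a * kronecker s b * kronecker t c * F r s t)
    = F a b c"
  by (simp add: mult.assoc sum_kronecker flip: sum_distrib_left)

text \<open>Pure contraction: summing the deltas over \<open>r\<close>, \<open>s\<close>,
  \<open>t\<close> leaves the three derivatives that occur in the Christoffel symbol, separately for
  each \<open>l\<close>.\<close>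

lemma solves_pde_system_iff_christoffel:
  "solves_pde_system M g \<longleftrightarrow> (\<forall>x\<in>M. \<forall>i j k. christoffel g x i j k = 0)"
proof -
  have "(\<Sum>r\<in>UNIV. \<Sum>s\<in>UNIV. \<Sum>t\<in>UNIV. c *
       (kronecker r l * kronecker s j * kronecker t k
        + kronecker r l * kronecker s k * kronecker t j
        - kronecker t l * kronecker r j * kronecker s k) * F r s t)
     = c * (F l j k + F l k j - F j k l)" for c and l j k :: 'a and F :: "'a \<Rightarrow> 'a \<Rightarrow> 'a \<Rightarrow> real"
  proof -
    \<comment> \<open>The last product is reordered so that its deltas carry \<open>r\<close>,
      \<open>s\<close>, \<open>t\<close> in this order, the shape \<open>sum_kronecker3\<close>
      matches.\<close>
    have eq: "c * (kronecker r l * kronecker s j * kronecker t k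
        + kronecker r l * kronecker s k * kronecker t j
        - kronecker t l * kronecker r j * kronecker s k) * F r s t =
      c * (kronecker r l * kronecker s j * kronecker t k * F r s t
        + kronecker r l * kronecker s k * kronecker t j * F r s t
        - kronecker r j * kronecker s k * kronecker t l * F r s t)" for r s t
      by (simp add: algebra_simps)
    show ?thesis
      unfolding eq sum_distrib_left[symmetric] sum.distrib sum_subtractf sum_kronecker3 ..
  qed
  then show ?thesis
    by (simp add: solves_pde_system_def christoffel_def)
qed

lemma sym_pos_def_mat_1: "sym_pos_def (mat 1)"
  by (simp add: sym_pos_def_def transpose_mat)

text \<open>A nonzero kernel vector \<open>x\<close> would violate positivity, as its inner product
  with \<open>A *v x\<close> is 0.\<close>

lemma sym_pos_def_invertible:
  assumes "sym_pos_def A"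
  shows "invertible A"
proof -
  have "x = 0" if "A *v x = 0" for x
    using assms that unfolding sym_pos_def_def by (metis inner_zero_right less_irrefl)
  then show ?thesis
    using invertible_left_inverse matrix_left_invertible_ker by blast
qed

lemma sym_pos_def_sym: "sym_pos_def A \<Longrightarrow> A $ i $ j = A $ j $ i"
  by (simp add: sym_pos_def_def transpose_def vec_eq_iff)

lemma has_derivative_component2:
  "(g has_derivative D) F \<Longrightarrow> ((\<lambda>y. g y $ i $ j) has_derivative (\<lambda>h. D h $ i $ j)) F"
  by (rule bounded_linear.has_derivative[OF bounded_linear_vec_nth
        bounded_linear.has_derivative[OF bounded_linear_vec_nth]])

lemma partial_deriv_component:
  assumes "(g has_derivative D) (at x)"
  shows "partial_deriv t (\<lambda>y. g y $ i $ j) x = D (axis t 1) $ i $ j"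
  unfolding partial_deriv_def
  using frechet_derivative_at[OF has_derivative_component2[OF assms, of i j]] by metis

text \<open>Near a point of the open set \<open>M\<close>, \<open>f\<close> coincides with a
  constant function; its values off \<open>M\<close> do not matter.\<close>

lemma has_derivative_zero_const_on_open:
  assumes "open M" "\<forall>x\<in>M. f x = c" "x \<in> M"
  shows "(f has_derivative (\<lambda>h. 0)) (at x)"
  by (rule has_derivative_transform_within_open[OF has_derivative_const[of c] assms(1,3)])
    (use assms in auto)

lemma smooth_on_const_on_open:
  assumes "open M" "\<forall>x\<in>M. f x = c"
  shows "smooth_on f M"
proof -
  have "Ck_on k f M" for k
    using assms(2)
  \<comment> \<open>The directional derivatives of \<open>f\<close> are again constant on
    \<open>M\<close>, now with value 0, so the induction must allow a new function and a new
    constant.\<close>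
  proof (induction k arbitrary: f c)
    case 0
    then show ?case
      using continuous_on_cong[of M M f "\<lambda>_. c"] by simp
  next
    case (Suc k)
    note D = has_derivative_zero_const_on_open[OF assms(1) Suc.prems]
    have "\<forall>x\<in>M. frechet_derivative f (at x) v = 0" for v
      using frechet_derivative_at[OF D] by metis
    then show ?case
      using D Suc.IH[of _ 0] by (auto simp: differentiable_def)
  qed
  then show ?thesis
    by (simp add: smooth_on_def)
qed

lemma christoffel_const_on_open:
  assumes "open M" "\<forall>x\<in>M. g x = c" "x \<in> M"
  shows "christoffel g x i j k = 0"
  by (simp add: christoffel_def
      partial_deriv_component[OF has_derivative_zero_const_on_open[OF assms]])

lemma invertible_matrix_inv_right:
  assumes "invertible A"
  shows "A ** matrix_inv A = mat 1"
  using someI_ex[OF assms[unfolded invertible_def]] by (simp add: matrix_inv_def)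

text \<open>For fixed \<open>j\<close> and \<open>k\<close>, the symbols are half the product of the
  inverse metric with the vector \<open>v\<close> of first-kind expressions; multiplying by
  \<open>g x\<close> recovers \<open>v = 0\<close>.\<close>

lemma christoffel_zero_imp_first_kind_zero:
  assumes "invertible (g x)" "\<And>i. christoffel g x i j k = 0"
  shows "partial_deriv k (\<lambda>y. g y $ m $ j) x + partial_deriv j (\<lambda>y. g y $ m $ k) x
    - partial_deriv m (\<lambda>y. g y $ j $ k) x = 0"
proof -
  define v where "v = (\<chi> l. partial_deriv k (\<lambda>y. g y $ l $ j) x
    + partial_deriv j (\<lambda>y. g y $ l $ k) x - partial_deriv l (\<lambda>y. g y $ j $ k) x)"
  have "matrix_inv (g x) *v v = 0"
    using assms(2) by (simp add: christoffel_def v_def matrix_vector_mult_def vec_eq_iff)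
  then have "(g x ** matrix_inv (g x)) *v v = 0"
    by (simp flip: matrix_vector_mul_assoc)
  then have "v = 0"
    by (simp add: invertible_matrix_inv_right[OF assms(1)])
  then show ?thesis
    by (simp add: v_def vec_eq_iff)
qed

lemma christoffel_zero_imp_derivative_zero:
  assumes "open M" "\<forall>y\<in>M. sym_pos_def (g y)" "x \<in> M" "(g has_derivative D) (at x)"
    and "\<And>i j k. christoffel g x i j k = 0"
  shows "D = (\<lambda>h. 0)"
proof -
  \<comment> \<open>The entries (i,j) and (j,i) of \<open>g\<close> agree on the open set
    \<open>M\<close>, hence near \<open>x\<close>, so by uniqueness their derivatives at
    \<open>x\<close> agree too.\<close>
  have sym: "D h $ i $ j = D h $ j $ i" for h i j
  proof -
    have "((\<lambda>y. g y $ j $ i) has_derivative (\<lambda>h. D h $ i $ j)) (at x)"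
      by (rule has_derivative_transform_within_open
          [OF has_derivative_component2[OF assms(4)] assms(1,3)])
        (use assms(2) sym_pos_def_sym in blast)
    from has_derivative_unique[OF this has_derivative_component2[OF assms(4)]]
    show ?thesis by metis
  qed
  have fk: "D (axis k 1) $ m $ j + D (axis j 1) $ m $ k - D (axis m 1) $ j $ k = 0" for m j k
    using christoffel_zero_imp_first_kind_zero[of g x j k m, OF _ assms(5)]
      sym_pos_def_invertible assms(2,3)
    by (auto simp: partial_deriv_component[OF assms(4)])
  \<comment> \<open>The two instances of \<open>fk\<close> differ by swapping \<open>m\<close> and
    \<open>j\<close>. In their sum the derivatives along \<open>j\<close> and \<open>m\<close>
    cancel, and \<open>sym\<close> merges the rest into twice the claimed entry.\<close>
  have "D (axis k 1) $ m $ j = 0" for m j k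
    using fk[of k m j] fk[of k j m] sym[of "axis k 1" j m] by simp
  then have ax: "D (axis k 1) = 0" for k
    by (simp add: vec_eq_iff)
  have lin: "linear D"
    using assms(4) has_derivative_linear by blast
  show ?thesis
  proof
    fix h
    have "D h = D (\<Sum>k\<in>UNIV. (h $ k) *\<^sub>R axis k 1)"
      using basis_expansion[of h] by (simp add: scalar_mult_eq_scaleR)
    also have "\<dots> = 0"
      by (simp add: linear_sum[OF lin] linear_cmul[OF lin] ax)
    finally show "D h = 0" .
  qed
qed

lemma christoffel_zero_imp_const:
  assumes "open M" "connected M" "riemannian_metric_on M g"
    and "\<forall>x\<in>M. \<forall>i j k. christoffel g x i j k = 0"
  shows "\<exists>c. sym_pos_def c \<and> (\<forall>x\<in>M. g x = c)"
proof (cases "M = {}")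
  \<comment> \<open>On the empty domain any positive definite constant serves; the identity matrix
    is taken.\<close>
  case True
  then show ?thesis
    using sym_pos_def_mat_1 by blast
next
  case False
  have pd: "\<forall>x\<in>M. sym_pos_def (g x)"
    using assms(3) by (simp add: riemannian_metric_on_def)
  have "Ck_on (Suc 0) g M"
    using assms(3) unfolding riemannian_metric_on_def smooth_on_def by blast
  then have "(g has_derivative (\<lambda>h. 0)) (at x)" if "x \<in> M" for x
    using that assms(4) christoffel_zero_imp_derivative_zero[OF assms(1) pd that]
    by (auto simp: differentiable_def)
  then have "\<exists>c. \<forall>x\<in>M. g x = c"
    using has_derivative_zero_unique_connected[OF assms(1,2)] by metis
  \<comment> \<open>The constant is positive definite because it is the value of \<open>g\<close> at
    some point of \<open>M\<close>.\<close>
  then show ?thesis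
    using False pd by (metis ex_in_conv)
qed

theorem theorem2p1:
  fixes M :: "(real^'n) set"
  assumes "open M" and "connected M"
  shows "(\<forall>g. riemannian_metric_on M g \<longrightarrow>
            (solves_pde_system M g \<longleftrightarrow> (\<forall>x\<in>M. \<forall>i j k. christoffel g x i j k = 0))) \<and>
         (\<forall>g. riemannian_metric_on M g \<and> solves_pde_system M g \<longleftrightarrow>
            (\<exists>c. sym_pos_def c \<and> (\<forall>x\<in>M. g x = c)))"
proof (intro conjI allI impI iffI)
  fix g :: "real^'n \<Rightarrow> real^'n^'n"
  assume "\<exists>c. sym_pos_def c \<and> (\<forall>x\<in>M. g x = c)"
  then obtain c where c: "sym_pos_def c" "\<forall>x\<in>M. g x = c"
    by blast
  then show "riemannian_metric_on M g"
    using smooth_on_const_on_open[OF assms(1)] by (simp add: riemannian_metric_on_def)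
  show "solves_pde_system M g"
    using christoffel_const_on_open[OF assms(1) c(2)]
    by (simp add: solves_pde_system_iff_christoffel)
\<comment> \<open>What remains is the equivalence with vanishing Christoffel symbols and the
  constancy of every solution.\<close>
qed (use christoffel_zero_imp_const[OF assms] in
    \<open>auto simp: solves_pde_system_iff_christoffel\<close>)

end
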